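(* Let $n_1,n_2$ be positive integers, $n=n_1n_2$, $1\le m\le n$, and let $A,B\in\mathbb{R}^{n\times n}$ be the matrices of the energy minimization problem for $m$ particles on the $n_1\times n_2$ toric grid (see context). Let $\lambda_{\min}$ be the smallest eigenvalue of $B$ and $\lambda_1$ the eigenvalue of $B$ corresponding to the eigenvector $e$ (the all-ones vector). Then the BDL-eigenvalue bound coincides with the projected eigenvalue bound of $QAP(A,B)$, i.e. $$\lambda_1\frac{m^2}{n}+\lambda_{\min}\Bigl(m-\frac{m^2}{n}\Bigr)=PB(A,B).$$
   Context: $[k]=\{1,\dots,k\}$. The grid points $[n_1]\times[n_2]$ are identified with $[n]$ by any fixed ordering. The Lee distance on the toric grid is $d_{\mathrm{Lee}}((x_1,y_1),(x_2,y_2))=\min(|x_1-x_2|,n_1-|x_1-x_2|)+\min(|y_1-y_2|,n_2-|y_1-y_2|)$. The matrix $B=(b_{ij})$ has $b_{ij}=1/d_{\mathrm{Lee}}(i,j)$ for distinct grid points $i\neq j$ and $b_{ii}=0$. The matrix $A=(a_{ij})$ has $a_{ij}=1$ if $i,j\le m$ and $a_{ij}=0$ otherwise. The all-ones vector $e$ is an eigenvector of $B$. The QAP in question is $QAP(A,B)=\min_{\pi\in S_n}\sum_{i,j=1}^n a_{ij}b_{\pi(i)\pi(j)}$. The BDL-eigenvalue bound is the quantity $\lambda_1\frac{m^2}{n}+\lambda_{\min}(m-\frac{m^2}{n})$. Projected eigenvalue bound: let $V$ be an $n\times(n-1)$ matrix whose columns form an orthonormal basis of the orthogonal complement of $e$;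 put $\tilde A=V^TAV$, $\tilde B=V^TBV$ with eigenvalue vectors $\lambda_{\tilde A},\mu_{\tilde B}$, and $D=(d_{ij})=\frac2nAee^TB$. Then $$PB(A,B)=\langle\lambda_{\tilde A},\mu_{\tilde B}\rangle^-+\min_{\varphi\in S_n}\sum_{i=1}^nd_{i\varphi(i)}-\frac{(e^TAe)(e^TBe)}{n^2},$$ where for vectors $x,y$ of length $k$, $\langle x,y\rangle^-=\min_{\varphi\in S_k}\sum_{i=1}^kx_{\varphi(i)}y_i$, and $S_k$ is the set of permutations of $[k]$. *)

theory Defs
  imports
    "Jordan_Normal_Form.Char_Poly"
    "Jordan_Normal_Form.VS_Connect"
    "HOL-Combinatorics.Permutations"
begin

text \<open>Matrix and vector indices run over \<open>{..<n}\<close>, so index \<open>i\<close> stands for \<open>i + 1 \<in> [n]\<close>.\<close>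

definition ones_vec :: "nat \<Rightarrow> real vec" where
  "ones_vec n = vec n (\<lambda>_. 1)"

definition ones_col :: "nat \<Rightarrow> real mat" where
  "ones_col n = mat_of_cols n [ones_vec n]"

definition lee_dist :: "nat \<Rightarrow> nat \<Rightarrow> nat \<times> nat \<Rightarrow> nat \<times> nat \<Rightarrow> real" where
  "lee_dist n1 n2 p q =
     min \<bar>real (fst p) - real (fst q)\<bar> (real n1 - \<bar>real (fst p) - real (fst q)\<bar>)
   + min \<bar>real (snd p) - real (snd q)\<bar> (real n2 - \<bar>real (snd p) - real (snd q)\<bar>)"

definition toric_grid :: "nat \<Rightarrow> nat \<Rightarrow> (nat \<times> nat) set" where
  "toric_grid n1 n2 = {1..n1} \<times> {1..n2}"

definition grid_ordering :: "nat \<Rightarrow> nat \<Rightarrow> (nat \<Rightarrow> nat \<times> nat) \<Rightarrow> bool" where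
  "grid_ordering n1 n2 pt \<longleftrightarrow> bij_betw pt {..<n1 * n2} (toric_grid n1 n2)"

definition particle_mat :: "nat \<Rightarrow> nat \<Rightarrow> real mat" where
  "particle_mat n m = mat n n (\<lambda>(i, j). if i < m \<and> j < m then 1 else 0)"

definition energy_mat :: "nat \<Rightarrow> nat \<Rightarrow> (nat \<Rightarrow> nat \<times> nat) \<Rightarrow> real mat" where
  "energy_mat n1 n2 pt = mat (n1 * n2) (n1 * n2)
     (\<lambda>(i, j). if i = j then 0 else 1 / lee_dist n1 n2 (pt i) (pt j))"

definition smallest_eigenvalue :: "real mat \<Rightarrow> real" where
  "smallest_eigenvalue M = Min {k. eigenvalue M k}"

text \<open>Meaningful only if \<open>v\<close> is an eigenvector of \<open>M\<close>; the eigenvalue is then unique.\<close>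

definition eigenvalue_of :: "real mat \<Rightarrow> real vec \<Rightarrow> real" where
  "eigenvalue_of M v = (THE k. eigenvector M v k)"

text \<open>The roots of the characteristic polynomial over the reals, repeated according to
  multiplicity and listed in increasing order.  For a symmetric matrix, the only case used, these
  are all the eigenvalues, so the dimension of the vector is that of the matrix.\<close>

definition eigenvalue_vec :: "real mat \<Rightarrow> real vec" where
  "eigenvalue_vec M = vec_of_list (sorted_list_of_multiset (proots (char_poly M)))"

text \<open>Intended for vectors of the same dimension.\<close>

definition min_scalar_prod :: "real vec \<Rightarrow> real vec \<Rightarrow> real" where
  "min_scalar_prod x y =
     Min ((\<lambda>\<phi>. \<Sum>i<dim_vec y. x $ \<phi> i * y $ i) ` {\<phi>. \<phi> permutes {..<dim_vec y}})"

definition orthonormal_basis_ones_compl :: "nat \<Rightarrow> real mat \<Rightarrow> bool" where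
  "orthonormal_basis_ones_compl n V \<longleftrightarrow>
     V \<in> carrier_mat n (n - 1) \<and>
     (\<forall>i<n - 1. \<forall>j<n - 1. col V i \<bullet> col V j = (if i = j then 1 else 0)) \<and>
     vec_space.col_space n V = vec_module.orthogonal_complement n {ones_vec n}"

definition projected_bound :: "nat \<Rightarrow> real mat \<Rightarrow> real mat \<Rightarrow> real mat \<Rightarrow> real" where
  "projected_bound n V A B =
     (let e = ones_col n;
          A' = V\<^sup>T * A * V;
          B' = V\<^sup>T * B * V;
          D = (2 / real n) \<cdot>\<^sub>m (A * e * e\<^sup>T * B)
      in min_scalar_prod (eigenvalue_vec A') (eigenvalue_vec B')
       + Min ((\<lambda>\<phi>. \<Sum>i<n. D $$ (i, \<phi> i)) ` {\<phi>. \<phi> permutes {..<n}})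
       - ((e\<^sup>T * A * e) $$ (0, 0)) * ((e\<^sup>T * B * e) $$ (0, 0)) / real n ^ 2)"

end

theory Submission
  imports Defs "Jordan_Normal_Form.Schur_Decomposition"
begin

text \<open>
  Write \<open>A = u u\<^sup>T\<close> with \<open>u\<close> the indicator vector of the first \<open>m\<close> indices. Since
  \<open>V V\<^sup>T = I - e e\<^sup>T / n\<close>, the projection \<open>V\<^sup>T A V = (V\<^sup>T u) (V\<^sup>T u)\<^sup>T\<close> has eigenvalues
  \<open>0, \<dots>, 0, m - m\<^sup>2 / n\<close>, so the minimal scalar product is \<open>m - m\<^sup>2 / n\<close> times the smallest
  eigenvalue of \<open>V\<^sup>T B V\<close>. The eigenvalues of \<open>V\<^sup>T B V\<close> are those of \<open>B\<close> with one copy of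
  \<open>\<lambda>\<^sub>1\<close> removed; for \<open>n \<ge> 2\<close>, as their sum is \<open>tr B - \<lambda>\<^sub>1 = -\<lambda>\<^sub>1 < 0\<close>, the smallest of them is negative and is
  therefore \<open>\<lambda>\<^sub>m\<^sub>i\<^sub>n\<close>. Finally \<open>e\<^sup>T B = \<lambda>\<^sub>1 e\<^sup>T\<close> makes the rows of \<open>D\<close> constant, so that the linear
  term does not depend on the permutation and equals \<open>2 \<lambda>\<^sub>1 m\<^sup>2 / n\<close>, of which the last term
  subtracts one half.
\<close>

subsection \<open>Eigenvalues of symmetric real matrices\<close>

lemma trace_mult_comm:
  fixes A B :: "'a :: comm_semiring_0 mat"
  assumes A: "A \<in> carrier_mat n k" and B: "B \<in> carrier_mat k n"
  shows "(\<Sum>i<n. (A * B) $$ (i, i)) = (\<Sum>i<k. (B * A) $$ (i, i))"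
proof -
  have "(\<Sum>i<n. (A * B) $$ (i, i)) = (\<Sum>i<n. \<Sum>j<k. A $$ (i, j) * B $$ (j, i))"
    using A B by (intro sum.cong) (auto simp: scalar_prod_def lessThan_atLeast0)
  also have "\<dots> = (\<Sum>j<k. \<Sum>i<n. B $$ (j, i) * A $$ (i, j))"
    by (subst sum.swap) (simp add: mult.commute)
  also have "\<dots> = (\<Sum>j<k. (B * A) $$ (j, j))"
    using A B by (intro sum.cong) (auto simp: scalar_prod_def lessThan_atLeast0)
  finally show ?thesis .
qed

text \<open>The Schur form \<open>T\<close> has \<open>es\<close> on its diagonal, and the trace is
  invariant under the similarity \<open>A = P * T * Q\<close>.\<close>

lemma trace_eq_sum_list_eigenvalues:
  fixes A :: "'a :: conjugatable_ordered_field mat"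
  assumes A: "A \<in> carrier_mat n n" and es: "char_poly A = (\<Prod>e\<leftarrow>es. [:- e, 1:])"
  shows "(\<Sum>i<n. A $$ (i, i)) = sum_list es"
proof -
  obtain T P Q where "schur_decomposition A es = (T, P, Q)"
    by (metis prod_cases3)
  from schur_decomposition[OF A es this]
  have sim: "similar_mat_wit A T P Q" and diag: "diag_mat T = es"
    by auto
  from similar_mat_witD2[OF A sim]
  have T: "T \<in> carrier_mat n n" and P: "P \<in> carrier_mat n n" and Q: "Q \<in> carrier_mat n n"
    and QP: "Q * P = 1\<^sub>m n" and AT: "A = P * T * Q"
    by auto
  have "(\<Sum>i<n. A $$ (i, i)) = (\<Sum>i<n. (P * (T * Q)) $$ (i, i))"
    using P T Q by (simp add: AT)
  also have "\<dots> = (\<Sum>i<n. (T * Q * P) $$ (i, i))"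
    using P T Q by (intro trace_mult_comm) auto
  also have "T * Q * P = T"
    using P T Q by (simp add: QP)
  also have "(\<Sum>i<n. T $$ (i, i)) = sum_list (diag_mat T)"
    using T by (simp add: diag_mat_def interv_sum_list_conv_sum_set_nat lessThan_atLeast0)
  finally show ?thesis
    by (simp add: diag)
qed

text \<open>For an eigenvector \<open>v\<close>, the Hermitian form \<open>q\<close> of
  \<open>A\<close> at \<open>v\<close> equals \<open>k\<close> times the squared norm of
  \<open>v\<close>. Conjugation fixes \<open>q\<close> because \<open>A\<close> is real and
  symmetric, so it fixes \<open>k\<close>.\<close>

lemma symmetric_real_mat_complex_eigenvalue_real:
  fixes A :: "real mat" and k :: complex
  assumes A: "A \<in> carrier_mat n n" and sym: "A\<^sup>T = A"
    and ev: "eigenvalue (map_mat of_real A) k"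
  shows "k \<in> \<real>"
proof -
  from ev obtain v where "eigenvector (map_mat of_real A) v k"
    by (auto simp: eigenvalue_def)
  then have v: "v \<in> carrier_vec n" "v \<noteq> 0\<^sub>v n"
    and Av: "map_mat of_real A *\<^sub>v v = k \<cdot>\<^sub>v v"
    using A by (auto simp: eigenvector_def)
  have sym': "A $$ (i, j) = A $$ (j, i)" if "i < n" "j < n" for i j
    using that A sym by (metis carrier_matD index_transpose_mat(1))
  have Avi: "(\<Sum>j<n. of_real (A $$ (i, j)) * v $ j) = k * v $ i" if "i < n" for i
    using arg_cong[OF Av, of "\<lambda>u. u $ i"] that A v
    by (simp add: scalar_prod_def lessThan_atLeast0)
  define s where "s = (\<Sum>i<n. (cmod (v $ i))\<^sup>2)"
  define q where "q = (\<Sum>i<n. \<Sum>j<n. cnj (v $ i) * (of_real (A $$ (i, j)) * v $ j))"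
  have q: "q = k * of_real s"
    unfolding q_def s_def
    by (simp add: Avi flip: sum_distrib_left)
      (simp add: sum_distrib_left complex_norm_square[unfolded of_real_power] mult_ac)
  have "cnj q = (\<Sum>i<n. \<Sum>j<n. cnj (v $ j) * (of_real (A $$ (j, i)) * v $ i))"
    by (auto simp: q_def mult_ac sym' intro!: sum.cong)
  also have "\<dots> = q"
    unfolding q_def by (rule sum.swap)
  finally have "cnj k * of_real s = k * of_real s"
    by (simp add: q)
  moreover have "s \<noteq> 0"
  proof
    assume "s = 0"
    then have "\<forall>i<n. v $ i = 0"
      by (simp add: s_def sum_nonneg_eq_0_iff)
    with v show False
      by auto
  qed
  ultimately show ?thesis
    by (simp add: Reals_cnj_iff)
qed

text \<open>The polynomial splits over the complex numbers. Its roots are real, and injectivity of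
  \<open>of_real\<close> on coefficients carries the factorization back to the reals.\<close>

lemma symmetric_real_mat_char_poly_splits:
  fixes A :: "real mat"
  assumes A: "A \<in> carrier_mat n n" and sym: "A\<^sup>T = A"
  obtains es where "char_poly A = (\<Prod>e\<leftarrow>es. [:- e, 1:])" "length es = n"
proof -
  interpret poly_hom: map_poly_comm_ring_hom complex_of_real ..
  let ?C = "map_mat complex_of_real A"
  have C: "?C \<in> carrier_mat n n"
    using A by simp
  obtain cs where cs: "char_poly ?C = (\<Prod>c\<leftarrow>cs. [:- c, 1:])" "length cs = n"
    using char_poly_factorized[OF C] by blast
  have real: "c \<in> \<real>" if "c \<in> set cs" for c
  proof (rule symmetric_real_mat_complex_eigenvalue_real[OF A sym])
    show "eigenvalue ?C c"
      using that by (auto simp: eigenvalue_root_char_poly[OF C] cs poly_prod_list prod_list_zero_iff)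
  qed
  have "cs = map of_real (map Re cs)"
    using real by (simp add: map_idI o_def of_real_Re)
  then have "char_poly ?C = (\<Prod>e\<leftarrow>map Re cs. [:- complex_of_real e, 1:])"
    by (metis (no_types, lifting) cs(1) map_eq_conv list.map_comp o_apply)
  also have "\<dots> = map_poly of_real (\<Prod>e\<leftarrow>map Re cs. [:- e, 1:])"
    by (simp add: poly_hom.hom_prod_list o_def)
  finally have "map_poly complex_of_real (char_poly A) = map_poly of_real (\<Prod>e\<leftarrow>map Re cs. [:- e, 1:])"
    by (simp add: of_real_hom.char_poly_hom[OF A])
  then have "char_poly A = (\<Prod>e\<leftarrow>map Re cs. [:- e, 1:])"
    by (simp add: poly_eq_iff coeff_map_poly)
  with cs(2) show thesis
    by (intro that[of "map Re cs"]) simp_all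
qed

lemma proots_prod_linear_factors:
  fixes es :: "'a :: idom list"
  shows "proots (\<Prod>e\<leftarrow>es. [:- e, 1:]) = mset es"
  proof (induction es)
  case (Cons e es)
  have "(\<Prod>e\<leftarrow>es. [:- e, 1:]) \<noteq> 0"
    by (auto simp: prod_list_zero_iff)
  with Cons show ?case
    by (simp add: proots_mult del: mult_pCons_left)
qed simp

text \<open>Later arguments handle \<open>eigenvalue_vec\<close> through this list. Its length
  \<open>n\<close> records that no root is lost by restricting to the reals.\<close>

lemma eigenvalue_vec_symmetric:
  fixes A :: "real mat"
  assumes A: "A \<in> carrier_mat n n" and sym: "A\<^sup>T = A"
  obtains es where "eigenvalue_vec A = vec_of_list es" "sorted es" "length es = n"
    "set es = {k. eigenvalue A k}" "sum_list es = (\<Sum>i<n. A $$ (i, i))"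
proof -
  obtain es where es: "char_poly A = (\<Prod>e\<leftarrow>es. [:- e, 1:])" "length es = n"
    using symmetric_real_mat_char_poly_splits[OF A sym] .
  show thesis
  proof
    show "eigenvalue_vec A = vec_of_list (sort es)"
      by (simp add: eigenvalue_vec_def es proots_prod_linear_factors)
    show "set (sort es) = {k. eigenvalue A k}"
      by (auto simp: eigenvalue_root_char_poly[OF A] es poly_prod_list prod_list_zero_iff)
    have "sum_list (sort es) = sum_list es"
      by (metis mset_sort sum_mset_sum_list)
    then show "sum_list (sort es) = (\<Sum>i<n. A $$ (i, i))"
      using trace_eq_sum_list_eigenvalues[OF A es(1)] by simp
  qed (use es in auto)
qed

section \<open>The spectrum of a rank-one square\<close>

definition outer_square_mat :: "real vec \<Rightarrow> real mat" where
  "outer_square_mat w = mat (dim_vec w) (dim_vec w) (\<lambda>(i, j). w $ i * w $ j)"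

text \<open>Since \<open>W *\<^sub>v v\<close> is always a multiple of \<open>w\<close>, every
  eigenvalue is 0 or \<open>w \<bullet> w\<close>. The trace \<open>w \<bullet> w\<close> leaves
  room for at most one nonzero entry; it is positive, so sorting puts it last.\<close>

lemma eigenvalue_vec_outer_square:
  assumes k: "0 < dim_vec w"
  shows "eigenvalue_vec (outer_square_mat w) = vec_of_list (replicate (dim_vec w - 1) 0 @ [w \<bullet> w])"
proof -
  define n where "n = dim_vec w"
  define W where "W = outer_square_mat w"
  have w: "w \<in> carrier_vec n" by (simp add: n_def)
  have W: "W \<in> carrier_mat n n" and sym: "W\<^sup>T = W"
    by (auto simp: W_def outer_square_mat_def n_def mult.commute)
  obtain es where es: "eigenvalue_vec W = vec_of_list es" "sorted es" "length es = n"
    "set es = {k. eigenvalue W k}" "sum_list es = (\<Sum>i<n. W $$ (i, i))"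
    using eigenvalue_vec_symmetric[OF W sym] .
  have sum: "sum_list es = w \<bullet> w"
    by (simp add: es scalar_prod_def W_def outer_square_mat_def n_def lessThan_atLeast0)
  have nonneg: "0 \<le> w \<bullet> w"
    by (auto simp: scalar_prod_def intro!: sum_nonneg)
  have Wv: "W *\<^sub>v v = (w \<bullet> v) \<cdot>\<^sub>v w" if "v \<in> carrier_vec n" for v
    using that by (intro eq_vecI)
      (auto simp: W_def outer_square_mat_def n_def scalar_prod_def sum_distrib_left sum_distrib_right mult_ac intro!: sum.cong)
  have set_es: "e = 0 \<or> e = w \<bullet> w" if e: "e \<in> set es" for e
  proof -
    obtain v where v: "v \<in> carrier_vec n" "v \<noteq> 0\<^sub>v n" "W *\<^sub>v v = e \<cdot>\<^sub>v v"
      using e W by (auto simp: es eigenvalue_def eigenvector_def)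
    have eq: "(w \<bullet> v) \<cdot>\<^sub>v w = e \<cdot>\<^sub>v v"
      using Wv v by simp
    \<comment> \<open>Pairing the eigenvector equation with \<open>w\<close>: either
      \<open>w \<bullet> v\<close> cancels and \<open>e = w \<bullet> w\<close>, or it is 0 and then
      \<open>e \<cdot>\<^sub>v v\<close> vanishes.\<close>
    have "(w \<bullet> v) * (w \<bullet> w) = e * (w \<bullet> v)"
      using arg_cong[OF eq, of "\<lambda>u. w \<bullet> u"] w v by simp
    moreover have "e = 0" if "w \<bullet> v = 0"
    proof (rule ccontr)
      assume "e \<noteq> 0"
      have "e * v $ i = 0" if "i < n" for i
        using arg_cong[OF eq, of "\<lambda>u. u $ i"] \<open>w \<bullet> v = 0\<close> that w v(1) by simp
      with \<open>e \<noteq> 0\<close> v show False by auto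
    qed
    ultimately show ?thesis by auto
  qed
  have es_eq: "es = butlast es @ [last es]"
    using es(3) k by (metis append_butlast_last_id length_0_conv n_def not_gr0)
  show ?thesis
  \<comment> \<open>If the two candidate values coincide, counting occurrences through the trace is
    impossible, but then all entries are 0 anyway.\<close>
  proof (cases "w \<bullet> w = 0")
    case True
    with set_es have "es = replicate n 0"
      by (metis es(3) replicate_eqI)
    moreover have "n = Suc (n - 1)" using k n_def by simp
    ultimately show ?thesis
      using True es(1) unfolding W_def n_def[symmetric] by (metis replicate_Suc replicate_append_same)
  next
    case False
    define c where "c = w \<bullet> w"
    have c: "c > 0" using False nonneg c_def by simp
    \<comment> \<open>The trace is \<open>c\<close>, so \<open>c\<close> has multiplicity one.\<close>
    have cnt: "sum_list xs = real (count_list xs c) * c" if "\<forall>e\<in>set xs. e = 0 \<or> e = c" for xs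
      using that by (induction xs) (auto simp: algebra_simps)
    have "count_list es c = 1"
      using cnt[of es] set_es sum c c_def by auto
    moreover have "last es = c"
    proof (rule ccontr)
      assume "last es \<noteq> c"
      with set_es es_eq have "last es = 0" unfolding c_def by (metis last_in_set append_is_Nil_conv not_Cons_self2)
      moreover have "x \<le> last es" if "x \<in> set es" for x
        using es(2) es_eq that by (metis (no_types, lifting) sorted_append Un_iff list.set_intros(1) set_append order_refl empty_iff list.set(1) set_ConsD)
      ultimately have "c \<notin> set es" using c by force
      then show False using \<open>count_list es c = 1\<close> by (simp add: count_list_0_iff)
    qed
    ultimately have "count_list (butlast es) c = 0"
      using arg_cong[OF es_eq, of "\<lambda>xs. count_list xs c"] by simp
    then have "\<forall>e\<in>set (butlast es). e = 0"
      using set_es by (metis c_def count_list_0_iff in_set_butlastD)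
    then have "butlast es = replicate (n - 1) 0"
      by (metis es(3) length_butlast replicate_eqI)
    with es_eq \<open>last es = c\<close> es(1) show ?thesis
      unfolding W_def c_def n_def[symmetric] by metis
  qed
qed

subsection \<open>The energy matrix of the toric grid\<close>

text \<open>Each \<open>x\<close> is replaced by its forward cyclic offset \<open>d\<close> from
  \<open>a\<close>. Then \<open>\<bar>a - x\<bar>\<close> is \<open>d\<close> or
  \<open>N - d\<close>, and the minimum does not see which, so the base point \<open>a\<close> drops
  out.\<close>

lemma sum_cyclic_distance:
  fixes F :: "real \<Rightarrow> 'a :: comm_monoid_add" and a N :: nat
  assumes a: "a \<in> {1..N}"
  shows "(\<Sum>x\<in>{1..N}. F (min \<bar>real a - real x\<bar> (real N - \<bar>real a - real x\<bar>)))
    = (\<Sum>d<N. F (min (real d) (real (N - d))))"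
proof (rule sum.reindex_bij_witness[where
      i = "\<lambda>d. if a + d \<le> N then a + d else a + d - N" and
      j = "\<lambda>x. if a \<le> x then x - a else x + N - a"])
  fix x assume x: "x \<in> {1..N}"
  have "real (x + N - a) = real x + real N - real a" "real (N - (x + N - a)) = real a - real x" if "x < a"
    using that a by (auto simp: of_nat_diff)
  moreover have "real (x - a) = real x - real a" "real (N - (x - a)) = real N - (real x - real a)" if "a \<le> x"
    using that a x by (auto simp: of_nat_diff)
  ultimately show "F (min (real (if a \<le> x then x - a else x + N - a)) (real (N - (if a \<le> x then x - a else x + N - a))))
      = F (min \<bar>real a - real x\<bar> (real N - \<bar>real a - real x\<bar>))"
    by (auto simp: not_le min.commute intro!: arg_cong[where f = F])
qed (use a in \<open>auto split: if_splits\<close>)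

lemma lee_dist_self [simp]: "lee_dist n1 n2 p p = 0"
  by (simp add: lee_dist_def)

lemma lee_dist_commute: "lee_dist n1 n2 p q = lee_dist n1 n2 q p"
  by (simp add: lee_dist_def abs_minus_commute)

text \<open>Coordinates in \<open>{1..N}\<close> differ by less than \<open>N\<close>, so the way
  around the torus is positive as well.\<close>

lemma lee_dist_pos:
  assumes "p \<in> toric_grid n1 n2" "q \<in> toric_grid n1 n2" "p \<noteq> q"
  shows "0 < lee_dist n1 n2 p q"
proof -
  have nonneg: "0 \<le> min \<bar>real a - real b\<bar> (real N - \<bar>real a - real b\<bar>)"
    and pos: "a \<noteq> b \<Longrightarrow> 0 < min \<bar>real a - real b\<bar> (real N - \<bar>real a - real b\<bar>)"
    if "a \<in> {1..N}" "b \<in> {1..N}" for a b N :: nat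
    using that by (auto simp: abs_real_def)
  have "fst p \<noteq> fst q \<or> snd p \<noteq> snd q"
    using assms(3) by (auto simp: prod_eq_iff)
  then show ?thesis
  proof
    assume "fst p \<noteq> fst q"
    then show ?thesis
      unfolding lee_dist_def
      by (intro add_pos_nonneg pos nonneg) (use assms(1,2) in \<open>simp_all add: toric_grid_def mem_Times_iff\<close>)
  next
    assume "snd p \<noteq> snd q"
    then show ?thesis
      unfolding lee_dist_def
      by (intro add_nonneg_pos pos nonneg) (use assms(1,2) in \<open>simp_all add: toric_grid_def mem_Times_iff\<close>)
  qed
qed

lemma energy_mat_carrier [simp]: "energy_mat n1 n2 pt \<in> carrier_mat (n1 * n2) (n1 * n2)"
  by (simp add: energy_mat_def)

text \<open>This includes the diagonal, because \<open>1 / 0 = 0\<close>.\<close>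

lemma energy_mat_index:
  assumes "i < n1 * n2" "j < n1 * n2"
  shows "energy_mat n1 n2 pt $$ (i, j) = 1 / lee_dist n1 n2 (pt i) (pt j)"
  using assms by (simp add: energy_mat_def)

lemma transpose_energy_mat: "(energy_mat n1 n2 pt)\<^sup>T = energy_mat n1 n2 pt"
  by (auto simp: energy_mat_def lee_dist_commute)

text \<open>The common row sum of the energy matrix, written over cyclic offsets so that no base
  point occurs. The offset \<open>(0, 0)\<close> contributes \<open>1 / 0 = 0\<close>, in agreement
  with the zero diagonal.\<close>

definition lee_energy :: "nat \<Rightarrow> nat \<Rightarrow> real" where
  "lee_energy n1 n2 = (\<Sum>d<n1. \<Sum>d'<n2. 1 / (min (real d) (real (n1 - d)) + min (real d') (real (n2 - d'))))"

lemma sum_inverse_lee_dist: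
  assumes "p \<in> toric_grid n1 n2"
  shows "(\<Sum>q\<in>toric_grid n1 n2. 1 / lee_dist n1 n2 p q) = lee_energy n1 n2"
proof -
  have p: "fst p \<in> {1..n1}" "snd p \<in> {1..n2}"
    using assms by (auto simp: toric_grid_def)
  show ?thesis
    unfolding toric_grid_def sum.cartesian_product' lee_dist_def lee_energy_def fst_conv snd_conv
    \<comment> \<open>The inner sum is shifted first, with the distance in the first coordinate left
      as the wildcard; then the outer sum.\<close>
    by (subst sum_cyclic_distance[OF p(2), where F = "\<lambda>t. 1 / (_ + t)"],
        subst sum_cyclic_distance[OF p(1), where F = "\<lambda>t. \<Sum>d'<n2. 1 / (t + min (real d') (real (n2 - d')))"])
      (rule refl)
qed

context
  fixes n1 n2 :: nat and pt :: "nat \<Rightarrow> nat \<times> nat"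
  assumes ordering: "grid_ordering n1 n2 pt"
begin

lemma energy_mat_row_sum:
  assumes "i < n1 * n2"
  shows "(\<Sum>j<n1 * n2. energy_mat n1 n2 pt $$ (i, j)) = lee_energy n1 n2"
proof -
  have bij: "bij_betw pt {..<n1 * n2} (toric_grid n1 n2)"
    using ordering by (simp add: grid_ordering_def)
  have "(\<Sum>j<n1 * n2. energy_mat n1 n2 pt $$ (i, j)) = (\<Sum>j<n1 * n2. 1 / lee_dist n1 n2 (pt i) (pt j))"
    using assms by (simp add: energy_mat_index)
  also have "\<dots> = (\<Sum>q\<in>toric_grid n1 n2. 1 / lee_dist n1 n2 (pt i) q)"
    by (rule sum.reindex_bij_betw[OF bij])
  also have "\<dots> = lee_energy n1 n2"
    using bij assms by (intro sum_inverse_lee_dist) (auto dest: bij_betw_apply)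
  finally show ?thesis .
qed

text \<open>This identifies \<lambda>_1 as \<open>lee_energy n1 n2\<close>.\<close>

lemma energy_mat_mult_ones:
  "energy_mat n1 n2 pt *\<^sub>v ones_vec (n1 * n2) = lee_energy n1 n2 \<cdot>\<^sub>v ones_vec (n1 * n2)"
proof (rule eq_vecI)
  fix i assume "i < dim_vec (lee_energy n1 n2 \<cdot>\<^sub>v ones_vec (n1 * n2))"
  then have i: "i < n1 * n2" by (simp add: ones_vec_def)
  with energy_mat_row_sum[OF i] show "(energy_mat n1 n2 pt *\<^sub>v ones_vec (n1 * n2)) $ i = (lee_energy n1 n2 \<cdot>\<^sub>v ones_vec (n1 * n2)) $ i"
    by (simp add: scalar_prod_def ones_vec_def lessThan_atLeast0 carrier_matD[OF energy_mat_carrier])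
qed (simp add: ones_vec_def carrier_matD[OF energy_mat_carrier])

text \<open>The value is read off row 0, whose entries are non-negative and whose entry at column 1
  is positive. For a single grid point the value would be 0.\<close>

lemma lee_energy_pos:
  assumes "2 \<le> n1 * n2"
  shows "0 < lee_energy n1 n2"
proof -
  have bij: "bij_betw pt {..<n1 * n2} (toric_grid n1 n2)"
    using ordering by (simp add: grid_ordering_def)
  have pt: "pt i \<in> toric_grid n1 n2" if "i < n1 * n2" for i
    using bij that by (auto dest: bij_betw_apply)
  have pos: "0 < energy_mat n1 n2 pt $$ (i, j)" if "i < n1 * n2" "j < n1 * n2" "i \<noteq> j" for i j
  proof -
    have "pt i \<noteq> pt j"
      using that bij by (auto simp: bij_betw_def inj_on_def)
    then show ?thesis
      using that by (auto simp: energy_mat_index intro!: lee_dist_pos pt)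
  qed
  have "0 < (\<Sum>j<n1 * n2. energy_mat n1 n2 pt $$ (0, j))"
  proof (rule sum_pos2[of _ 1])
    show "0 \<le> energy_mat n1 n2 pt $$ (0, j)" if j: "j \<in> {..<n1 * n2}" for j
    proof (cases "j = 0")
      case False
      with j show ?thesis
        by (intro less_imp_le[OF pos]) (auto intro: gr0I)
    qed (use j in \<open>simp add: energy_mat_index\<close>)
    show "0 < energy_mat n1 n2 pt $$ (0, 1)"
      using assms by (intro pos) linarith+
  qed (use assms in auto)
  moreover have "0 < n1 * n2"
    using assms by linarith
  ultimately show ?thesis
    by (simp only: energy_mat_row_sum)
qed

end

subsection \<open>Projection onto the complement of the all-ones vector\<close>

text \<open>A nonzero entry of \<open>v\<close> determines the factor, so the definite description
  is well defined.\<close>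

lemma eigenvalue_of_eq:
  assumes "A *\<^sub>v v = k \<cdot>\<^sub>v v" "v \<in> carrier_vec (dim_row A)" "v \<noteq> 0\<^sub>v (dim_row A)"
  shows "eigenvalue_of A v = k"
  unfolding eigenvalue_of_def
proof (rule the_equality)
  fix l assume "eigenvector A v l"
  then have eq: "l \<cdot>\<^sub>v v = k \<cdot>\<^sub>v v"
    using assms by (simp add: eigenvector_def)
  obtain i where "i < dim_vec v" "v $ i \<noteq> 0"
    using assms(2,3) by (metis carrier_vecD eq_vecI index_zero_vec(1) zero_carrier_vec)
  then show "l = k"
    using arg_cong[OF eq, of "\<lambda>u. u $ i"] by simp
qed (use assms in \<open>simp add: eigenvector_def\<close>)

text \<open>Each permutation pairs \<open>c\<close> with one entry of \<open>ys\<close> and all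
  other entries with 0. As \<open>c\<close> is non-negative, the best partner is the smallest entry,
  at index 0.\<close>

lemma min_scalar_prod_single:
  assumes k: "0 < k" and c: "0 \<le> c" and ys: "sorted ys" "length ys = k"
  shows "min_scalar_prod (vec_of_list (replicate (k - 1) 0 @ [c])) (vec_of_list ys) = c * ys ! 0"
proof -
  let ?x = "replicate (k - 1) 0 @ [c]"
  have x: "?x ! i = (if i = k - 1 then c else 0)" if "i < k" for i
    using that by (auto simp: nth_append)
  have value_eq: "(\<Sum>i<k. ?x ! \<phi> i * ys ! i) = c * ys ! inv_into UNIV \<phi> (k - 1)"
    if "\<phi> permutes {..<k}" for \<phi>
  proof -
    have "(\<Sum>i<k. ?x ! \<phi> i * ys ! i) = (\<Sum>i<k. if i = inv_into UNIV \<phi> (k - 1) then c * ys ! i else 0)"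
    proof (rule sum.cong)
      fix i assume "i \<in> {..<k}"
      then have "\<phi> i < k"
        using permutes_in_image[OF that, of i] by simp
      moreover have "i = inv_into UNIV \<phi> (k - 1) \<longleftrightarrow> \<phi> i = k - 1"
        using permutes_inv_eq[OF that] by metis
      ultimately show "?x ! \<phi> i * ys ! i = (if i = inv_into UNIV \<phi> (k - 1) then c * ys ! i else 0)"
        by (simp only: x) simp
    qed simp
    also have "\<dots> = c * ys ! inv_into UNIV \<phi> (k - 1)"
      using permutes_in_image[OF permutes_inv[OF that], of "k - 1"] k by simp
    finally show ?thesis .
  qed
  have "Min ((\<lambda>\<phi>. \<Sum>i<k. ?x ! \<phi> i * ys ! i) ` {\<phi>. \<phi> permutes {..<k}}) = c * ys ! 0"
  proof (rule Min_eqI)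
    show "finite ((\<lambda>\<phi>. \<Sum>i<k. ?x ! \<phi> i * ys ! i) ` {\<phi>. \<phi> permutes {..<k}})"
      by (intro finite_imageI finite_permutations) simp
  next
    fix y assume "y \<in> (\<lambda>\<phi>. \<Sum>i<k. ?x ! \<phi> i * ys ! i) ` {\<phi>. \<phi> permutes {..<k}}"
    then obtain \<phi> where \<phi>: "\<phi> permutes {..<k}" "y = c * ys ! inv_into UNIV \<phi> (k - 1)"
      using value_eq by blast
    have "inv_into UNIV \<phi> (k - 1) < k"
      using permutes_in_image[OF permutes_inv[OF \<phi>(1)], of "k - 1"] k by simp
    then have "ys ! 0 \<le> ys ! inv_into UNIV \<phi> (k - 1)"
      using ys by (intro sorted_nth_mono) auto
    with c \<phi>(2) show "c * ys ! 0 \<le> y"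
      by (simp add: mult_left_mono)
  next
    \<comment> \<open>The minimum is attained by exchanging index 0 with the last index, where
      \<open>c\<close> sits.\<close>
    let ?\<tau> = "Transposition.transpose 0 (k - 1)"
    have \<tau>: "?\<tau> permutes {..<k}"
      using k by (intro permutes_swap_id) auto
    have "c * ys ! 0 = (\<Sum>i<k. ?x ! ?\<tau> i * ys ! i)"
      using value_eq[OF \<tau>] by simp
    with \<tau> show "c * ys ! 0 \<in> (\<lambda>\<phi>. \<Sum>i<k. ?x ! \<phi> i * ys ! i) ` {\<phi>. \<phi> permutes {..<k}}"
      by blast
  qed
  then show ?thesis
    using ys(2) by (simp add: min_scalar_prod_def vec_of_list_index)
qed

section \<open>Products with the all-ones vector and with rank-one matrices\<close>

lemma ones_vec_carrier [simp]: "ones_vec n \<in> carrier_vec n"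
  by (simp add: ones_vec_def)

lemma index_ones_vec [simp]: "i < n \<Longrightarrow> ones_vec n $ i = 1"
  by (simp add: ones_vec_def)

lemma dim_ones_vec [simp]: "dim_vec (ones_vec n) = n"
  by (simp add: ones_vec_def)

lemma scalar_prod_ones_vec: "v \<bullet> ones_vec n = (\<Sum>i<n. v $ i)"
  by (simp add: scalar_prod_def lessThan_atLeast0)

lemma ones_col_carrier [simp]: "ones_col n \<in> carrier_mat n 1"
  unfolding ones_col_def using mat_of_cols_carrier(1)[of n "[ones_vec n]"] by simp

lemma index_ones_col [simp]: "i < n \<Longrightarrow> ones_col n $$ (i, 0) = 1"
  by (simp add: ones_col_def mat_of_cols_index)

lemma dim_ones_col [simp]: "dim_row (ones_col n) = n" "dim_col (ones_col n) = 1"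
  using ones_col_carrier[of n] by (auto simp del: ones_col_carrier)

lemma mult_ones_col_index:
  assumes "A \<in> carrier_mat n n" "i < n"
  shows "(A * ones_col n) $$ (i, 0) = (\<Sum>j<n. A $$ (i, j))"
  using assms by (simp add: scalar_prod_def lessThan_atLeast0)

lemma ones_quadratic_form:
  assumes "A \<in> carrier_mat n n"
  shows "((ones_col n)\<^sup>T * A * ones_col n) $$ (0, 0) = (\<Sum>i<n. \<Sum>j<n. A $$ (i, j))"
proof -
  have "(ones_col n)\<^sup>T * A * ones_col n = (ones_col n)\<^sup>T * (A * ones_col n)"
    using assms by (intro assoc_mult_mat) auto
  also have "\<dots> $$ (0, 0) = (\<Sum>i<n. (A * ones_col n) $$ (i, 0))"
    using assms by (simp add: scalar_prod_def lessThan_atLeast0)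
  finally show ?thesis
    using assms by (simp add: mult_ones_col_index del: index_mult_mat)
qed

text \<open>Reassociated as a column times a row, the product is the outer product of the row sums
  of \<open>A\<close> and the column sums of \<open>B\<close>.\<close>

lemma mult_ones_mult_index:
  assumes A: "A \<in> carrier_mat n n" and B: "B \<in> carrier_mat n n" and "i < n" "j < n"
  shows "(A * ones_col n * (ones_col n)\<^sup>T * B) $$ (i, j) = (\<Sum>k<n. A $$ (i, k)) * (\<Sum>k<n. B $$ (k, j))"
proof -
  have "A * ones_col n * (ones_col n)\<^sup>T * B = (A * ones_col n) * ((ones_col n)\<^sup>T * B)"
    using A B by (intro assoc_mult_mat) auto
  then show ?thesis
    using assms by (simp add: scalar_prod_def lessThan_atLeast0)
qed

text \<open>With \<open>M = V\<close> this keeps the projection of the particle matrix within reach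
  of \<open>eigenvalue_vec_outer_square\<close>.\<close>

lemma transpose_mult_outer_square_mult:
  assumes M: "M \<in> carrier_mat n k" and u: "u \<in> carrier_vec n"
  shows "M\<^sup>T * outer_square_mat u * M = outer_square_mat (M\<^sup>T *\<^sub>v u)"
proof (rule eq_matI)
  fix i j
  assume "i < dim_row (outer_square_mat (M\<^sup>T *\<^sub>v u))" "j < dim_col (outer_square_mat (M\<^sup>T *\<^sub>v u))"
  then have ij: "i < k" "j < k"
    using M by (auto simp: outer_square_mat_def)
  have "(M\<^sup>T * outer_square_mat u * M) $$ (i, j)
      = (\<Sum>b<n. (\<Sum>a<n. M $$ (a, i) * (u $ a * u $ b)) * M $$ (b, j))"
    using M u ij by (simp add: outer_square_mat_def scalar_prod_def lessThan_atLeast0)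
  also have "\<dots> = (\<Sum>a<n. M $$ (a, i) * u $ a) * (\<Sum>b<n. M $$ (b, j) * u $ b)"
    by (simp add: sum_distrib_left sum_distrib_right mult_ac)
  also have "\<dots> = outer_square_mat (M\<^sup>T *\<^sub>v u) $$ (i, j)"
    using M u ij by (simp add: outer_square_mat_def scalar_prod_def lessThan_atLeast0)
  finally show "(M\<^sup>T * outer_square_mat u * M) $$ (i, j) = outer_square_mat (M\<^sup>T *\<^sub>v u) $$ (i, j)" .
qed (use M u in \<open>auto simp: outer_square_mat_def\<close>)

section \<open>The orthogonal projection given by the basis matrix \<open>V\<close>\<close>

context
  fixes n :: nat and V :: "real mat"
  assumes n: "0 < n" and basis: "orthonormal_basis_ones_compl n V"
begin

lemma basis_carrier: "V \<in> carrier_mat n (n - 1)"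
  using basis by (simp add: orthonormal_basis_ones_compl_def)

text \<open>The column space condition in terms of images, so that a vector orthogonal to the ones
  vector can be traded for a preimage under \<open>V\<close>.\<close>

lemma basis_range:
  "{y \<in> carrier_vec n. \<exists>x\<in>carrier_vec (n - 1). V *\<^sub>v x = y}
    = {x \<in> carrier_vec n. x \<bullet> ones_vec n = 0}"
  using basis vec_space.col_space_eq[OF basis_carrier] basis_carrier
  by (simp add: orthonormal_basis_ones_compl_def vec_module.orthogonal_complement_def)

lemma basis_transpose_mult: "V\<^sup>T * V = 1\<^sub>m (n - 1)"
  using basis basis_carrier
  by (intro eq_matI) (auto simp: orthonormal_basis_ones_compl_def)

lemma basis_transpose_mult_vec:
  assumes "y \<in> carrier_vec (n - 1)"
  shows "V\<^sup>T *\<^sub>v (V *\<^sub>v y) = y"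
  using assms basis_carrier basis_transpose_mult
  by (metis assoc_mult_mat_vec one_mult_mat_vec transpose_carrier_mat)

lemma basis_mult_vec_orthogonal:
  assumes "y \<in> carrier_vec (n - 1)"
  shows "(V *\<^sub>v y) \<bullet> ones_vec n = 0"
proof -
  have "V *\<^sub>v y \<in> carrier_vec n"
    using basis_carrier assms by simp
  then have "V *\<^sub>v y \<in> {x \<in> carrier_vec n. x \<bullet> ones_vec n = 0}"
    unfolding basis_range[symmetric] using assms by blast
  then show ?thesis
    by simp
qed

lemma basis_transpose_ones: "V\<^sup>T *\<^sub>v ones_vec n = 0\<^sub>v (n - 1)"
proof (rule eq_vecI)
  fix i assume "i < dim_vec (0\<^sub>v (n - 1) :: real vec)"
  then have i: "i < n - 1" by simp
  have "V *\<^sub>v unit_vec (n - 1) i = col V i"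
    using basis_carrier i by (intro eq_vecI) auto
  with basis_mult_vec_orthogonal[of "unit_vec (n - 1) i"] have "col V i \<bullet> ones_vec n = 0"
    by simp
  with i basis_carrier show "(V\<^sup>T *\<^sub>v ones_vec n) $ i = 0\<^sub>v (n - 1) $ i"
    by simp
qed (use basis_carrier in simp)

text \<open>As \<open>V\<^sup>T\<close> is a left inverse of \<open>V\<close>, the product
  \<open>V * V\<^sup>T\<close> fixes the range of \<open>V\<close>.\<close>

lemma basis_mult_transpose_orthogonal:
  assumes "p \<in> carrier_vec n" "p \<bullet> ones_vec n = 0"
  shows "V *\<^sub>v (V\<^sup>T *\<^sub>v p) = p"
proof -
  obtain x where "x \<in> carrier_vec (n - 1)" "V *\<^sub>v x = p"
    using basis_range assms by blast
  then show ?thesis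
    using basis_transpose_mult_vec by metis
qed

text \<open>The right-hand side \<open>p\<close> is \<open>u\<close> without its component along the
  ones vector. That component is killed by \<open>V\<^sup>T\<close>, and \<open>p\<close> itself is
  fixed by \<open>V * V\<^sup>T\<close>.\<close>

lemma basis_mult_transpose_vec:
  assumes u: "u \<in> carrier_vec n"
  shows "V *\<^sub>v (V\<^sup>T *\<^sub>v u) = u - ((u \<bullet> ones_vec n) / real n) \<cdot>\<^sub>v ones_vec n"
proof -
  define p where "p = u - ((u \<bullet> ones_vec n) / real n) \<cdot>\<^sub>v ones_vec n"
  have p: "p \<in> carrier_vec n"
    using u by (simp add: p_def)
  have "p \<bullet> ones_vec n = 0"
    using u n by (simp add: p_def scalar_prod_ones_vec sum_subtractf)
  moreover have "V\<^sup>T *\<^sub>v p = V\<^sup>T *\<^sub>v u"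
  proof -
    let ?q = "((u \<bullet> ones_vec n) / real n) \<cdot>\<^sub>v ones_vec n"
    have Vt: "V\<^sup>T \<in> carrier_mat (n - 1) n"
      using basis_carrier by simp
    have "V\<^sup>T *\<^sub>v p = V\<^sup>T *\<^sub>v u - V\<^sup>T *\<^sub>v ?q"
      unfolding p_def using u by (intro mult_minus_distrib_mat_vec[OF Vt]) auto
    also have "V\<^sup>T *\<^sub>v ?q = 0\<^sub>v (n - 1)"
      by (auto simp: mult_mat_vec[OF Vt] basis_transpose_ones)
    finally show ?thesis
      using mult_mat_vec_carrier[OF Vt u] by simp
  qed
  ultimately show ?thesis
    using basis_mult_transpose_orthogonal[OF p] by (simp add: p_def)
qed

lemma basis_mult_transpose_index:
  assumes ij: "i < n" "j < n"
  shows "(V * V\<^sup>T) $$ (i, j) = (if i = j then 1 else 0) - 1 / real n"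
proof -
  have Vt: "V\<^sup>T \<in> carrier_mat (n - 1) n"
    using basis_carrier by simp
  have col: "V\<^sup>T *\<^sub>v unit_vec n j = col V\<^sup>T j"
    using ij basis_carrier by (intro eq_vecI) auto
  have unit: "unit_vec n j \<bullet> ones_vec n = 1"
    using scalar_prod_left_unit[OF ones_vec_carrier ij(2)] ij by simp
  have "(V * V\<^sup>T) $$ (i, j) = col (V * V\<^sup>T) j $ i"
    using ij basis_carrier by simp
  also have "col (V * V\<^sup>T) j = V *\<^sub>v (V\<^sup>T *\<^sub>v unit_vec n j)"
    unfolding col by (rule col_mult2[OF basis_carrier Vt ij(2)])
  also have "\<dots> = unit_vec n j - (1 / real n) \<cdot>\<^sub>v ones_vec n"
    unfolding basis_mult_transpose_vec[OF unit_vec_carrier] unit ..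
  also have "\<dots> $ i = (if i = j then 1 else 0) - 1 / real n"
    using ij by simp
  finally show ?thesis .
qed

text \<open>For the indicator vector of the particles this yields \<open>m - m^2 / n\<close>, the
  only possibly nonzero eigenvalue of the projected particle matrix.\<close>

lemma norm_basis_transpose_mult:
  assumes u: "u \<in> carrier_vec n"
  shows "(V\<^sup>T *\<^sub>v u) \<bullet> (V\<^sup>T *\<^sub>v u) = u \<bullet> u - (u \<bullet> ones_vec n)\<^sup>2 / real n"
proof -
  have "(V\<^sup>T *\<^sub>v u) \<bullet> (V\<^sup>T *\<^sub>v u) = u \<bullet> (V *\<^sub>v (V\<^sup>T *\<^sub>v u))"
    using u basis_carrier by (intro transpose_vec_mult_scalar) auto
  also have "\<dots> = u \<bullet> u - (u \<bullet> ones_vec n) / real n * (u \<bullet> ones_vec n)"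
    using u by (simp add: basis_mult_transpose_vec scalar_prod_minus_distrib[of _ n])
  finally show ?thesis
    by (simp add: power2_eq_square)
qed

section \<open>The projection of a symmetric matrix that has the ones vector as an
  eigenvector\<close>

context
  fixes B :: "real mat" and l :: real
  assumes B: "B \<in> carrier_mat n n" and sym: "B\<^sup>T = B"
    and B_ones: "B *\<^sub>v ones_vec n = l \<cdot>\<^sub>v ones_vec n"
begin

text \<open>Symmetry moves \<open>B\<close> to the ones vector. Hence \<open>B\<close> preserves its
  complement, and eigenvectors for eigenvalues other than \<open>l\<close> lie in that
  complement.\<close>

lemma mult_vec_scalar_ones:
  assumes "v \<in> carrier_vec n"
  shows "(B *\<^sub>v v) \<bullet> ones_vec n = l * (v \<bullet> ones_vec n)"
  using transpose_vec_mult_scalar[of B n n "ones_vec n" v] B sym assms B_ones by simp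

lemma projection_carrier: "V\<^sup>T * B * V \<in> carrier_mat (n - 1) (n - 1)"
  using B basis_carrier by simp

lemma projection_symmetric: "(V\<^sup>T * B * V)\<^sup>T = V\<^sup>T * B * V"
proof -
  have "(V\<^sup>T * B * V)\<^sup>T = V\<^sup>T * (V\<^sup>T * B)\<^sup>T"
    using B basis_carrier by (intro transpose_mult) auto
  also have "(V\<^sup>T * B)\<^sup>T = B * V"
    using B basis_carrier sym by (subst transpose_mult[of _ "n - 1" n _ n]) auto
  finally show ?thesis
    using B basis_carrier by simp
qed

lemma projection_mult_vec:
  assumes "y \<in> carrier_vec (n - 1)"
  shows "(V\<^sup>T * B * V) *\<^sub>v y = V\<^sup>T *\<^sub>v (B *\<^sub>v (V *\<^sub>v y))"
proof -
  have Vt: "V\<^sup>T \<in> carrier_mat (n - 1) n"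
    using basis_carrier by simp
  have "(V\<^sup>T * B * V) *\<^sub>v y = (V\<^sup>T * B) *\<^sub>v (V *\<^sub>v y)"
    using Vt B by (intro assoc_mult_mat_vec[OF _ basis_carrier assms]) auto
  also have "\<dots> = V\<^sup>T *\<^sub>v (B *\<^sub>v (V *\<^sub>v y))"
    using basis_carrier assms by (intro assoc_mult_mat_vec[OF Vt B]) auto
  finally show ?thesis .
qed

text \<open>An eigenvector \<open>y\<close> lifts to \<open>V *\<^sub>v y\<close>. Its image under
  \<open>B\<close> stays in the complement, where \<open>V * V\<^sup>T\<close> is the identity, so
  the outer \<open>V\<^sup>T\<close> can be undone.\<close>

lemma eigenvalue_of_projection:
  assumes "eigenvalue (V\<^sup>T * B * V) k"
  shows "eigenvalue B k"
proof -
  obtain y where y: "y \<in> carrier_vec (n - 1)" "y \<noteq> 0\<^sub>v (n - 1)"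
    and ev: "V\<^sup>T *\<^sub>v (B *\<^sub>v (V *\<^sub>v y)) = k \<cdot>\<^sub>v y"
    using assms projection_carrier projection_mult_vec by (auto simp: eigenvalue_def eigenvector_def)
  define v where "v = V *\<^sub>v y"
  have v: "v \<in> carrier_vec n"
    using basis_carrier y by (simp add: v_def)
  have "V\<^sup>T *\<^sub>v v = y"
    using y by (simp add: v_def basis_transpose_mult_vec)
  then have "v \<noteq> 0\<^sub>v n"
    using y(2) basis_carrier by auto
  have "(B *\<^sub>v v) \<bullet> ones_vec n = 0"
    using mult_vec_scalar_ones[OF v] basis_mult_vec_orthogonal[OF y(1)] by (simp add: v_def)
  then have "B *\<^sub>v v = V *\<^sub>v (V\<^sup>T *\<^sub>v (B *\<^sub>v v))"
    using B v by (simp add: basis_mult_transpose_orthogonal)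
  also have "\<dots> = k \<cdot>\<^sub>v v"
    using ev basis_carrier y by (simp add: v_def mult_mat_vec[of _ n "n - 1"])
  finally show ?thesis
    using \<open>v \<noteq> 0\<^sub>v n\<close> v B by (auto simp: eigenvalue_def eigenvector_def)
qed

text \<open>For \<open>k \<noteq> l\<close> an eigenvector \<open>v\<close> is orthogonal to the
  ones vector, so \<open>V\<^sup>T *\<^sub>v v\<close> loses no information. For
  \<open>k = l\<close> the ones vector itself would be sent to 0.\<close>

lemma eigenvalue_projection:
  assumes "eigenvalue B k" "k \<noteq> l"
  shows "eigenvalue (V\<^sup>T * B * V) k"
proof -
  obtain v where v: "v \<in> carrier_vec n" "v \<noteq> 0\<^sub>v n" and ev: "B *\<^sub>v v = k \<cdot>\<^sub>v v"
    using assms(1) B by (auto simp: eigenvalue_def eigenvector_def)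
  have "k * (v \<bullet> ones_vec n) = l * (v \<bullet> ones_vec n)"
    using mult_vec_scalar_ones[OF v(1)] v by (simp add: ev)
  with assms(2) have VVv: "V *\<^sub>v (V\<^sup>T *\<^sub>v v) = v"
    using v by (intro basis_mult_transpose_orthogonal) auto
  define y where "y = V\<^sup>T *\<^sub>v v"
  have y: "y \<in> carrier_vec (n - 1)"
    using basis_carrier v by (simp add: y_def)
  have "y \<noteq> 0\<^sub>v (n - 1)"
  proof
    assume "y = 0\<^sub>v (n - 1)"
    then have "v = V *\<^sub>v 0\<^sub>v (n - 1)"
      using VVv by (simp add: y_def)
    also have "\<dots> = 0\<^sub>v n"
      using basis_carrier by auto
    finally show False
      using v by simp
  qed
  moreover have "(V\<^sup>T * B * V) *\<^sub>v y = k \<cdot>\<^sub>v y"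
    unfolding projection_mult_vec[OF y] using basis_carrier v
    by (simp add: y_def VVv ev mult_mat_vec[of _ "n - 1" n])
  ultimately show ?thesis
    using y projection_carrier basis_carrier by (auto simp: eigenvalue_def eigenvector_def)
qed

lemma sum_entries: "(\<Sum>i<n. \<Sum>j<n. B $$ (i, j)) = real n * l"
proof -
  have "(\<Sum>j<n. B $$ (i, j)) = l" if "i < n" for i
    using arg_cong[OF B_ones, of "\<lambda>u. u $ i"] that B
    by (simp add: scalar_prod_def lessThan_atLeast0)
  then show ?thesis by simp
qed

text \<open>Cyclicity turns the trace into that of \<open>B * (V * V\<^sup>T)\<close>, and the
  correction to the trace of \<open>B\<close> is the sum of all entries of \<open>B\<close> divided
  by \<open>n\<close>.\<close>

lemma trace_projection: "(\<Sum>i<n - 1. (V\<^sup>T * B * V) $$ (i, i)) = (\<Sum>i<n. B $$ (i, i)) - l"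
proof -
  have "(\<Sum>i<n - 1. (V\<^sup>T * B * V) $$ (i, i)) = (\<Sum>i<n - 1. (V\<^sup>T * (B * V)) $$ (i, i))"
    using B basis_carrier by simp
  also have "\<dots> = (\<Sum>i<n. (B * V * V\<^sup>T) $$ (i, i))"
    using B basis_carrier by (intro trace_mult_comm) auto
  also have "B * V * V\<^sup>T = B * (V * V\<^sup>T)"
    using B basis_carrier by simp
  also have "(\<Sum>i<n. (B * (V * V\<^sup>T)) $$ (i, i)) = (\<Sum>i<n. \<Sum>j<n. B $$ (i, j) * (V * V\<^sup>T) $$ (j, i))"
  proof (rule sum.cong)
    fix i assume "i \<in> {..<n}"
    then show "(B * (V * V\<^sup>T)) $$ (i, i) = (\<Sum>j<n. B $$ (i, j) * (V * V\<^sup>T) $$ (j, i))"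
      using B basis_carrier
      by (subst index_mult_mat) (auto simp: scalar_prod_def lessThan_atLeast0 intro!: sum.cong)
  qed simp
  also have "\<dots> = (\<Sum>i<n. B $$ (i, i) - (\<Sum>j<n. B $$ (i, j)) / real n)"
  proof (rule sum.cong)
    fix i assume i: "i \<in> {..<n}"
    then have "(\<Sum>j<n. B $$ (i, j) * (V * V\<^sup>T) $$ (j, i))
        = (\<Sum>j<n. (if j = i then B $$ (i, j) else 0) - B $$ (i, j) / real n)"
      by (intro sum.cong) (auto simp: basis_mult_transpose_index algebra_simps simp del: index_mult_mat)
    with i show "(\<Sum>j<n. B $$ (i, j) * (V * V\<^sup>T) $$ (j, i)) = B $$ (i, i) - (\<Sum>j<n. B $$ (i, j)) / real n"
      by (simp add: sum_subtractf flip: sum_divide_distrib)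
  qed simp
  also have "\<dots> = (\<Sum>i<n. B $$ (i, i)) - l"
    using n by (simp add: sum_subtractf sum_entries flip: sum_divide_distrib)
  finally show ?thesis .
qed

text \<open>The spectra of \<open>B\<close> and of its projection can differ only in
  \<open>l\<close>. The projected eigenvalues sum to \<open>- l < 0\<close>, so the least of them is
  negative and the positive \<open>l\<close> cannot affect the minimum.\<close>

lemma eigenvalue_vec_projection:
  assumes n2: "2 \<le> n" and l: "0 < l" and trace: "(\<Sum>i<n. B $$ (i, i)) = 0"
  obtains es where "eigenvalue_vec (V\<^sup>T * B * V) = vec_of_list es" "sorted es"
    "length es = n - 1" "es ! 0 = smallest_eigenvalue B"
proof -
  obtain es where es: "eigenvalue_vec (V\<^sup>T * B * V) = vec_of_list es" "sorted es" "length es = n - 1"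
    "set es = {k. eigenvalue (V\<^sup>T * B * V) k}" "sum_list es = (\<Sum>i<n - 1. (V\<^sup>T * B * V) $$ (i, i))"
    using eigenvalue_vec_symmetric[OF projection_carrier projection_symmetric] .
  \<comment> \<open>Only the finiteness of the spectrum of \<open>B\<close> is taken from
    \<open>bs\<close>, as \<open>Min\<close> requires it.\<close>
  obtain bs where bs: "set bs = {k. eigenvalue B k}"
    using eigenvalue_vec_symmetric[OF B sym] by metis
  have le: "es ! 0 \<le> k" if "k \<in> set es" for k
    using that es(2) by (auto simp: in_set_conv_nth intro: sorted_nth_mono)
  have neg: "es ! 0 < 0"
  proof (rule ccontr)
    assume "\<not> es ! 0 < 0"
    then have "0 \<le> sum_list es"
      using le by (intro sum_list_nonneg) force
    with l show False
      unfolding es(5) trace_projection trace by simp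
  qed
  have "smallest_eigenvalue B = es ! 0"
    unfolding smallest_eigenvalue_def
  proof (rule Min_eqI)
    show "finite {k. eigenvalue B k}"
      by (metis bs List.finite_set)
    show "es ! 0 \<le> k" if "k \<in> {k. eigenvalue B k}" for k
      using that le[of k] neg l es(4) eigenvalue_projection[of k] by (cases "k = l") auto
    \<comment> \<open>The list has \<open>n - 1\<close> entries, so \<open>2 \<le> n\<close> makes
      it nonempty.\<close>
    have "es ! 0 \<in> set es"
      using es(3) n2 by (intro nth_mem) simp
    then show "es ! 0 \<in> {k. eigenvalue B k}"
      using es(4) eigenvalue_of_projection by auto
  qed
  with es that show thesis by simp
qed

end

end

section \<open>Evaluation of the three terms of the projected bound\<close>

theorem proposition3p4:
  fixes n1 n2 n m :: nat and pt :: "nat \<Rightarrow> nat \<times> nat" and A B V :: "real mat"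
  assumes "0 < n1" and "0 < n2" and "n = n1 * n2" and "1 \<le> m" and "m \<le> n"
    and "grid_ordering n1 n2 pt"
    and "A = particle_mat n m"
    and "B = energy_mat n1 n2 pt"
    and "orthonormal_basis_ones_compl n V"
  shows "eigenvalue_of B (ones_vec n) * (real m ^ 2 / real n)
       + smallest_eigenvalue B * (real m - real m ^ 2 / real n)
       = projected_bound n V A B"
proof -
  define l where "l = lee_energy n1 n2"
  define c where "c = real m - real m ^ 2 / real n"
  define u where "u = vec n (\<lambda>i. if i < m then 1 else 0 :: real)"
  have n: "0 < n"
    using assms by simp
  have A: "A \<in> carrier_mat n n" and u: "u \<in> carrier_vec n"
    by (simp_all add: assms(7) particle_mat_def u_def)
  have A_outer: "A = outer_square_mat u"
    by (auto simp: assms(7) particle_mat_def outer_square_mat_def u_def)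
  have B: "B \<in> carrier_mat n n" and sym: "B\<^sup>T = B"
    and B_ones: "B *\<^sub>v ones_vec n = l \<cdot>\<^sub>v ones_vec n"
    using assms by (simp_all add: transpose_energy_mat energy_mat_mult_ones l_def)
  have "ones_vec n \<noteq> 0\<^sub>v n"
    using n by (metis index_ones_vec index_zero_vec(1) zero_neq_one)
  then have eigenvalue_ones: "eigenvalue_of B (ones_vec n) = l"
    using B by (intro eigenvalue_of_eq[OF B_ones]) auto
  \<comment> \<open>The diagonal entries are \<open>1 / 0\<close>, which is 0.\<close>
  have trace: "(\<Sum>i<n. B $$ (i, i)) = 0"
    using assms by (simp add: energy_mat_index)
  have sum_if: "(\<Sum>i<n. if i < m then x else 0) = real m * x" for x :: real
    using assms(5) by (simp add: sum.If_cases Int_absorb1 lessThan_def[symmetric])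
  have A_row: "(\<Sum>j<n. A $$ (i, j)) = (if i < m then real m else 0)" if "i < n" for i
    using that sum_if[of 1] by (simp add: assms(7) particle_mat_def)
  have B_col: "(\<Sum>i<n. B $$ (i, j)) = l" if "j < n" for j
    using arg_cong[OF B_ones, of "\<lambda>x. x $ j"] that B sym
    by (simp add: scalar_prod_def lessThan_atLeast0)
      (metis (no_types, lifting) sum.cong atLeastLessThan_iff index_transpose_mat(1) carrier_matD)
  have A_sum: "(\<Sum>i<n. \<Sum>j<n. A $$ (i, j)) = real m ^ 2"
    using sum_if[of "real m"] by (simp add: A_row power2_eq_square)

  \<comment> \<open>This is \<open>m * (n - m) / n\<close> with \<open>m \<le> n\<close>; the sign
    fixes which end of the sorted list the minimum selects.\<close>
  have c_nonneg: "0 \<le> c"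
    using assms(4,5) n by (simp add: c_def power2_eq_square divide_simps mult_mono)
  have quadratic: "min_scalar_prod (eigenvalue_vec (V\<^sup>T * A * V)) (eigenvalue_vec (V\<^sup>T * B * V))
      = smallest_eigenvalue B * c"
  \<comment> \<open>For \<open>n = 1\<close> the projected matrices are empty and the scalar product
    is an empty sum. The right-hand side vanishes as well, since \<open>c = 0\<close>.\<close>
  proof (cases "n = 1")
    case True
    then have "m = 1"
      using assms(4,5) by simp
    have "V\<^sup>T * B * V \<in> carrier_mat 0 0" "(V\<^sup>T * B * V)\<^sup>T = V\<^sup>T * B * V"
      using projection_carrier[OF n assms(9) B sym B_ones] projection_symmetric[OF n assms(9) B sym B_ones] True
      by auto
    from eigenvalue_vec_symmetric[OF this] have "dim_vec (eigenvalue_vec (V\<^sup>T * B * V)) = 0"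
      by (metis dim_vec_of_list)
    then show ?thesis
      using True \<open>m = 1\<close> by (simp add: c_def min_scalar_prod_def)
  next
    case False
    with n have n2: "2 \<le> n" by simp
    then have l: "0 < l"
      using lee_energy_pos[OF assms(6)] assms(3) by (simp add: l_def)
    obtain es where es: "eigenvalue_vec (V\<^sup>T * B * V) = vec_of_list es" "sorted es"
      "length es = n - 1" "es ! 0 = smallest_eigenvalue B"
      using eigenvalue_vec_projection[OF n assms(9) B sym B_ones n2 l trace] .
    define w where "w = V\<^sup>T *\<^sub>v u"
    note V = basis_carrier[OF n assms(9)]
    \<comment> \<open>As \<open>u\<close> has entries 0 and 1, both \<open>u \<bullet> u\<close> and
      \<open>u \<bullet> ones_vec n\<close> equal \<open>m\<close>.\<close>
    have "w \<bullet> w = c"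
      using norm_basis_transpose_mult[OF n assms(9) u] sum_if[of 1]
      by (simp add: w_def c_def scalar_prod_ones_vec)
        (simp add: u_def scalar_prod_def lessThan_atLeast0 if_distrib cong: if_cong)
    moreover have "dim_vec w = n - 1"
      using V by (simp add: w_def)
    ultimately have "eigenvalue_vec (V\<^sup>T * A * V) = vec_of_list (replicate (n - 1 - 1) 0 @ [c])"
      using eigenvalue_vec_outer_square[of w] transpose_mult_outer_square_mult[OF V u] n2
      by (simp add: A_outer w_def)
    then show ?thesis
      using min_scalar_prod_single[OF _ c_nonneg es(2,3)] n2 es by simp
  qed

  define D where "D = (2 / real n) \<cdot>\<^sub>m (A * ones_col n * (ones_col n)\<^sup>T * B)"
  \<comment> \<open>The column index disappears because all column sums of \<open>B\<close> equal
    \<open>l\<close>.\<close>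
  have D: "D $$ (i, j) = 2 / real n * (if i < m then real m * l else 0)" if "i < n" "j < n" for i j
    using that A B mult_ones_mult_index[OF A B that] by (simp add: D_def A_row B_col del: index_mult_mat(1))
  have "(\<Sum>i<n. D $$ (i, \<phi> i)) = 2 * real m ^ 2 * l / real n" if "\<phi> permutes {..<n}" for \<phi>
  proof -
    have "(\<Sum>i<n. D $$ (i, \<phi> i)) = (\<Sum>i<n. if i < m then 2 / real n * (real m * l) else 0)"
      using that permutes_in_image[OF that] by (intro sum.cong) (auto simp: D)
    then show ?thesis
      by (simp add: sum_if power2_eq_square)
  qed
  then have "(\<lambda>\<phi>. \<Sum>i<n. D $$ (i, \<phi> i)) ` {\<phi>. \<phi> permutes {..<n}} = {2 * real m ^ 2 * l / real n}"
    using permutes_id[of "{..<n}"] by (auto simp: image_iff intro!: exI[of _ id])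
  then have linear: "Min ((\<lambda>\<phi>. \<Sum>i<n. D $$ (i, \<phi> i)) ` {\<phi>. \<phi> permutes {..<n}}) = 2 * real m ^ 2 * l / real n"
    by simp
  \<comment> \<open>The entries of \<open>A\<close> sum to \<open>m^2\<close> and those of
    \<open>B\<close> to \<open>n * l\<close>, so the last term is
    \<open>l * m^2 / n\<close>.\<close>
  have "projected_bound n V A B
      = smallest_eigenvalue B * c + 2 * real m ^ 2 * l / real n - real m ^ 2 * (real n * l) / real n ^ 2"
    unfolding projected_bound_def Let_def D_def[symmetric] quadratic linear
      ones_quadratic_form[OF A] ones_quadratic_form[OF B] A_sum sum_entries[OF n assms(9) B sym B_ones] ..
  also have "\<dots> = l * (real m ^ 2 / real n) + smallest_eigenvalue B * c"
    using n by (simp add: field_simps power2_eq_square)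
  finally show ?thesis
    by (simp add: eigenvalue_ones c_def)
qed

end
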